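(* Let $X$ be a compact connected manifold and let $\Gamma$ be a countable group acting on $X$ by homeomorphisms. Assume that for every $\gamma \in \Gamma$ with $\gamma \neq \mathrm{id}$ the fixed point set $\mathrm{Fix}(\gamma)=\{x\in X : \gamma x = x\}$ is contained in a submanifold of $X$ of codimension two. Then the $\Gamma$-action on $X$ is $C^0$ OE rigid.
   Context: Manifolds are topological manifolds. Groups act by homeomorphisms, and all actions are taken to be faithful. Two actions $(X',\Gamma')$ and $(X,\Gamma)$ of groups on topological spaces are orbit equivalent if there is a homeomorphism $f:X'\to X$ which maps the orbit relation of $\Gamma'$ to the orbit relation of $\Gamma$ (that is, $x,y$ lie in the same $\Gamma'$-orbit if and only if $f(x),f(y)$ lie in the same $\Gamma$-orbit). Such an $f$ is called an orbit equivalence. An orbit equivalence $f$ is equivariant if there is a group isomorphism $\varphi:\Gamma'\to\Gamma$ with $f(\gamma' x)=\varphi(\gamma')f(x)$ for all $\gamma'\in\Gamma'$ and $x\in X'$. The action of $\Gamma$ on $X$ is $C^0$ OE rigid if, for every action $(X',\Gamma')$, every orbit equivalence from $(X',\Gamma')$ to $(X,\Gamma)$ is equivariant. *)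

theory Defs
  imports "HOL-Analysis.Analysis" "HOL-Algebra.Group_Action"
begin

text \<open>Topological manifolds are without boundary. The empty space is an
  \<open>n\<close>-manifold for every \<open>n\<close>.\<close>

definition topological_manifold :: "nat \<Rightarrow> 'a topology \<Rightarrow> bool" where
  "topological_manifold n X \<longleftrightarrow>
     Hausdorff_space X \<and> second_countable X \<and>
     (\<forall>x\<in>topspace X. \<exists>U V. openin X U \<and> x \<in> U \<and> openin (Euclidean_space n) V \<and>
        subtopology X U homeomorphic_space subtopology (Euclidean_space n) V)"

text \<open>A submanifold is a subset that is a manifold in the subspace topology; it need not be
  closed, connected or locally flat. The disjunct \<open>S = {}\<close> matters only when \<open>n < c\<close>, where
  the codimension-\<open>c\<close> submanifolds have negative dimension and hence are empty.\<close>

definition submanifold_of_codim :: "nat \<Rightarrow> nat \<Rightarrow> 'a topology \<Rightarrow> 'a set \<Rightarrow> bool" where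
  "submanifold_of_codim c n X S \<longleftrightarrow>
     topological_manifold n X \<and> S \<subseteq> topspace X \<and>
     (S = {} \<or> (\<exists>k. k + c = n \<and> topological_manifold k (subtopology X S)))"

definition faithful_top_action ::
    "'a topology \<Rightarrow> ('g, 'm) monoid_scheme \<Rightarrow> ('g \<Rightarrow> 'a \<Rightarrow> 'a) \<Rightarrow> bool" where
  "faithful_top_action X G \<phi> \<longleftrightarrow>
     faithful_action G (topspace X) \<phi> \<and> (\<forall>g\<in>carrier G. homeomorphic_map X X (\<phi> g))"

definition orbit_equivalence ::
    "'b topology \<Rightarrow> ('h, 'k) monoid_scheme \<Rightarrow> ('h \<Rightarrow> 'b \<Rightarrow> 'b) \<Rightarrow>
     'a topology \<Rightarrow> ('g, 'm) monoid_scheme \<Rightarrow> ('g \<Rightarrow> 'a \<Rightarrow> 'a) \<Rightarrow> ('b \<Rightarrow> 'a) \<Rightarrow> bool" where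
  "orbit_equivalence X' G' \<phi>' X G \<phi> f \<longleftrightarrow>
     homeomorphic_map X' X f \<and>
     (\<forall>x\<in>topspace X'. \<forall>y\<in>topspace X'. y \<in> orbit G' \<phi>' x \<longleftrightarrow> f y \<in> orbit G \<phi> (f x))"

definition equivariant_map ::
    "'b topology \<Rightarrow> ('h, 'k) monoid_scheme \<Rightarrow> ('h \<Rightarrow> 'b \<Rightarrow> 'b) \<Rightarrow>
     ('g, 'm) monoid_scheme \<Rightarrow> ('g \<Rightarrow> 'a \<Rightarrow> 'a) \<Rightarrow> ('b \<Rightarrow> 'a) \<Rightarrow> bool" where
  "equivariant_map X' G' \<phi>' G \<phi> f \<longleftrightarrow>
     (\<exists>\<theta>\<in>iso G' G. \<forall>g\<in>carrier G'. \<forall>x\<in>topspace X'. f (\<phi>' g x) = \<phi> (\<theta> g) (f x))"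

text \<open>HOL cannot quantify over types inside a formula, so the types carrying the points of the
  competing space \<open>X'\<close> and the elements of the competing group \<open>G'\<close> are parameters; a theorem
  about \<open>C0_OE_rigid TYPE('b) TYPE('h)\<close> with free \<open>'b\<close> and \<open>'h\<close> covers all of them.\<close>

definition C0_OE_rigid ::
    "'b itself \<Rightarrow> 'h itself \<Rightarrow>
     'a topology \<Rightarrow> ('g, 'm) monoid_scheme \<Rightarrow> ('g \<Rightarrow> 'a \<Rightarrow> 'a) \<Rightarrow> bool" where
  "C0_OE_rigid TYPE('b) TYPE('h) X G \<phi> \<longleftrightarrow>
     (\<forall>(X' :: 'b topology) (G' :: 'h monoid) \<phi>' f.
        faithful_top_action X' G' \<phi>' \<and> orbit_equivalence X' G' \<phi>' X G \<phi> f \<longrightarrow>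
        equivariant_map X' G' \<phi>' G \<phi> f)"

end

theory Submission
  imports Defs "HOL-Homology.Invariance_of_Domain"
begin

text \<open>An orbit equivalence turns a homeomorphism \<open>\<phi>' a\<close> of \<open>X'\<close> into a homeomorphism \<open>h\<close> of \<open>X\<close> with
  \<open>h x \<in> orbit G \<phi> x\<close> for all \<open>x\<close>. The countably many closed sets \<open>{x. h x = \<phi> g x}\<close> cover \<open>X\<close> and
  overlap only inside fixed point sets of nontrivial elements. A closed subset of a codimension-two
  submanifold, however wildly embedded, leaves every connected open set connected: locally it is a closed
  subset of \<open>\<real>\<^sup>n\<close> that embeds in \<open>\<real>\<^sup>n\<^sup>-\<^sup>2\<close>, and the components of the complement of a closed subset of \<open>\<real>\<^sup>n\<close>
  are counted by an invariant of that subset. Hence removing all the fixed point sets leaves a connected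
  dense set, and a Baire category argument shows that one of the sets \<open>{x. h x = \<phi> g x}\<close> is all
  of \<open>X\<close>. A point with trivial stabilizer, again from Baire, shows that \<open>a \<mapsto> g\<close> is onto.\<close>

subsection \<open>Closed sets that do not separate connected open sets\<close>

text \<open>A splitting of the intersection consists of two disjoint compact sets, which disjoint
  open sets \<open>U\<close> and \<open>V\<close> separate. By compactness some \<open>C n\<close>
  already lies in \<open>U \<union> V\<close>, which contradicts its connectedness.\<close>

lemma connectedin_Inter_decseq:
  fixes C :: "nat \<Rightarrow> 'a set"
  assumes X: "compact_space X" "Hausdorff_space X"
    and C: "\<And>n. closedin X (C n)" "\<And>n. connectedin X (C n)" "decseq C"
  shows "connectedin X (\<Inter>n. C n)"
proof -
  define K where "K = (\<Inter>n. C n)"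
  have clo: "closedin X K"
    unfolding K_def using C(1) by auto
  have False if E: "closedin X E1" "closedin X E2" "K \<subseteq> E1 \<union> E2"
      "E1 \<inter> E2 \<inter> K = {}" "E1 \<inter> K \<noteq> {}" "E2 \<inter> K \<noteq> {}" for E1 E2
  proof -
    have "compactin X (E1 \<inter> K)" "compactin X (E2 \<inter> K)"
      using E clo X closedin_compact_space by blast+
    moreover have "disjnt (E1 \<inter> K) (E2 \<inter> K)"
      using E(4) by (auto simp: disjnt_def)
    ultimately obtain U V where UV: "openin X U" "openin X V" "E1 \<inter> K \<subseteq> U" "E2 \<inter> K \<subseteq> V" "disjnt U V"
      using Hausdorff_space_compact_separation[OF X(2)] by metis
    have "\<exists>n. C n - (U \<union> V) = {}"
    proof (rule ccontr)
      assume "\<nexists>n. C n - (U \<union> V) = {}"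
      moreover have "closedin X (C n - (U \<union> V))" for n
        by (intro closedin_diff C openin_Un UV)
      moreover have "decseq (\<lambda>n. C n - (U \<union> V))"
        using C(3) by (force simp: decseq_def)
      ultimately have "(\<Inter>n. C n - (U \<union> V)) \<noteq> {}"
        by (intro compact_space_imp_nest[OF X(1)]) auto
      then have "K - (U \<union> V) \<noteq> {}"
        unfolding K_def by blast
      with E(3) UV show False
        by blast
    qed
    then obtain n where n: "C n \<subseteq> U \<union> V"
      by blast
    have "K \<subseteq> C n"
      unfolding K_def by blast
    then have "U \<inter> C n \<noteq> {}" "V \<inter> C n \<noteq> {}"
      using E(5,6) UV(3,4) by blast+
    moreover have "U \<inter> V \<inter> C n = {}"
      using UV(5) by (auto simp: disjnt_def)
    ultimately show False
      using connectedinD[OF C(2) UV(1,2) n] by blast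
  qed
  then show ?thesis
    using clo closedin_subset unfolding K_def[symmetric] connectedin_closedin by metis
qed

text \<open>The points that can be joined to \<open>p\<close> by such a set form a relatively clopen
  part of \<open>W\<close>, by the usual chain argument.\<close>

lemma connected_open_compactly_contained:
  assumes X: "locally_connected_space X" "regular_space X"
    and W: "openin X W" "connectedin X W" "p \<in> W" "q \<in> W"
  obtains V where "openin X V" "connectedin X V" "p \<in> V" "q \<in> V" "X closure_of V \<subseteq> W"
proof -
  define R where "R x \<longleftrightarrow> (\<exists>V. openin X V \<and> connectedin X V \<and> p \<in> V \<and> x \<in> V \<and> X closure_of V \<subseteq> W)" for x
  have nbhd: "\<exists>N. openin X N \<and> connectedin X N \<and> x \<in> N \<and> N \<subseteq> W \<and> X closure_of N \<subseteq> W" if "x \<in> W" for x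
  proof -
    obtain U K where "openin X U" "closedin X K" "x \<in> U" "U \<subseteq> K" "K \<subseteq> W"
      using X(2) W(1) \<open>x \<in> W\<close> unfolding neighbourhood_base_of_closedin[symmetric] neighbourhood_base_of
      by metis
    moreover obtain N where "openin X N" "connectedin X N" "x \<in> N" "N \<subseteq> U"
      using X(1) \<open>openin X U\<close> \<open>x \<in> U\<close> unfolding locally_connected_space by metis
    ultimately show ?thesis
      by (meson closure_of_minimal order_trans)
  qed
  \<comment> \<open>\<open>R\<close> is constant on each small connected \<open>N\<close>, since
    \<open>N\<close> can be adjoined to any \<open>V\<close> that meets it. Hence both truth values
    of \<open>R\<close> are taken on open sets.\<close>
  have step: "R y \<longleftrightarrow> R x" if N: "openin X N" "connectedin X N" "X closure_of N \<subseteq> W" "x \<in> N" "y \<in> N" for x y N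
  proof -
    have "R y" if "R x" "x \<in> N" "y \<in> N" for x y
    proof -
      obtain V where V: "openin X V" "connectedin X V" "p \<in> V" "x \<in> V" "X closure_of V \<subseteq> W"
        using \<open>R x\<close> R_def by blast
      have "connectedin X (V \<union> N)"
        using V N that by (intro connectedin_Un) auto
      then show ?thesis
        unfolding R_def using V N that by (intro exI[of _ "V \<union> N"]) (auto simp: closure_of_Un)
    qed
    then show ?thesis using that by blast
  qed
  have sub: "openin X {x \<in> W. R x = b}" for b
  proof (subst openin_subopen, intro ballI)
    fix x assume x: "x \<in> {x \<in> W. R x = b}"
    then obtain N where N: "openin X N" "connectedin X N" "x \<in> N" "N \<subseteq> W" "X closure_of N \<subseteq> W"
      using nbhd by blast
    then have "N \<subseteq> {x \<in> W. R x = b}"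
      using step[OF N(1,2,5,3)] x by blast
    then show "\<exists>T. openin X T \<and> x \<in> T \<and> T \<subseteq> {x \<in> W. R x = b}"
      using N by blast
  qed
  obtain N where "openin X N" "connectedin X N" "p \<in> N" "X closure_of N \<subseteq> W"
    using nbhd W(3) by blast
  then have "R p"
    unfolding R_def by blast
  then have "R q"
    using connectedinD[OF W(2) sub[of True] sub[of False]] W(3,4) by blast
  then show ?thesis
    using that unfolding R_def by blast
qed

definition nonseparating :: "'a topology \<Rightarrow> 'a set \<Rightarrow> bool" where
  "nonseparating X F \<longleftrightarrow> closedin X F \<and> X interior_of F = {} \<and>
     (\<forall>W. openin X W \<and> connectedin X W \<longrightarrow> connectedin X (W - F))"

text \<open>Given a splitting of \<open>W - F\<close>, each small \<open>N - F\<close> lies on one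
  side. Filling in the points of \<open>F\<close> turns the two sides into disjoint open sets that
  cover \<open>W\<close>.\<close>

lemma nonseparating_local:
  assumes F: "closedin X F"
    and loc: "\<And>x W. openin X W \<Longrightarrow> x \<in> W \<Longrightarrow>
      \<exists>N. openin X N \<and> x \<in> N \<and> N \<subseteq> W \<and> connectedin X (N - F) \<and> N - F \<noteq> {}"
  shows "nonseparating X F"
proof -
  have dense: "W - F \<noteq> {}" if W: "openin X W" "W \<noteq> {}" for W
    using loc[OF W(1)] W(2) by blast
  have "connectedin X (W - F)" if W: "openin X W" "connectedin X W" for W
    unfolding connectedin
  proof (intro conjI notI)
    show "W - F \<subseteq> topspace X"
      using W openin_subset by blast
    assume "\<exists>E1 E2. openin X E1 \<and> openin X E2 \<and> W - F \<subseteq> E1 \<union> E2 \<and> E1 \<inter> E2 \<inter> (W - F) = {} \<and>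
       E1 \<inter> (W - F) \<noteq> {} \<and> E2 \<inter> (W - F) \<noteq> {}"
    then obtain E1 E2 where E: "openin X E1" "openin X E2" "W - F \<subseteq> E1 \<union> E2" "E1 \<inter> E2 \<inter> (W - F) = {}"
       "E1 \<inter> (W - F) \<noteq> {}" "E2 \<inter> (W - F) \<noteq> {}"
      by blast
    \<comment> \<open>The largest open subset of \<open>W\<close> whose points outside
      \<open>F\<close> all lie in \<open>E\<close>.\<close>
    define T where "T E = \<Union>{N. openin X N \<and> N \<subseteq> W \<and> N - F \<subseteq> E}" for E
    have ope: "openin X (T E)" for E
      unfolding T_def by (rule openin_Union) blast
    have sub: "W \<subseteq> T E1 \<union> T E2"
    proof
      fix x assume "x \<in> W"
      then obtain N where N: "openin X N" "x \<in> N" "N \<subseteq> W" "connectedin X (N - F)" "N - F \<noteq> {}"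
        using loc W(1) by meson
      have "E1 \<inter> (N - F) = {} \<or> E2 \<inter> (N - F) = {}"
        using N(3,4) E unfolding connectedin by blast
      with N(3) E(3) have "N - F \<subseteq> E1 \<or> N - F \<subseteq> E2"
        by blast
      with N show "x \<in> T E1 \<union> T E2"
        unfolding T_def by blast
    qed
    \<comment> \<open>A nonempty overlap would be open, hence contain a point outside
      \<open>F\<close>, and that point would lie in both \<open>E1\<close> and
      \<open>E2\<close>.\<close>
    have "T E1 \<inter> T E2 = {}"
    proof (rule ccontr)
      assume "T E1 \<inter> T E2 \<noteq> {}"
      then obtain M N where "openin X M" "openin X N" "M \<subseteq> W" "M - F \<subseteq> E1" "N - F \<subseteq> E2" "M \<inter> N \<noteq> {}"
        unfolding T_def by blast
      with dense[of "M \<inter> N"] E(4) show False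
        by blast
    qed
    then have "T E1 \<inter> T E2 \<inter> W = {}"
      by blast
    moreover have T: "T E - F \<subseteq> E" for E
      unfolding T_def by blast
    have "T E1 \<inter> W \<noteq> {}" "T E2 \<inter> W \<noteq> {}"
      using E(4,5,6) sub T[of E1] T[of E2] by blast+
    ultimately show False
      using connectedinD[OF W(2) ope ope sub] by blast
  qed
  moreover have "X interior_of F = {}"
    using dense[of "X interior_of F"] interior_of_subset[of X F] by auto
  ultimately show ?thesis
    using F unfolding nonseparating_def by blast
qed

text \<open>Two points of the complement lie in the intersection of a decreasing sequence of continua,
  the \<open>n\<close>-th of which avoids the \<open>n\<close>-th member of the family.\<close>

lemma connectedin_Diff_countable_nonseparating:
  assumes X: "compact_space X" "Hausdorff_space X" "locally_connected_space X"
    and \<F>: "countable \<F>" "\<And>F. F \<in> \<F> \<Longrightarrow> nonseparating X F"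
    and W: "openin X W" "connectedin X W"
  shows "connectedin X (W - \<Union>\<F>)"
proof (cases "\<F> = {}")
  case False
  then obtain F :: "nat \<Rightarrow> 'a set" where F: "\<F> = range F"
    using \<F>(1) by (metis uncountable_def)
  have reg: "regular_space X"
    using X compact_Hausdorff_imp_regular_space by blast
  have "\<exists>C. connectedin X C \<and> p \<in> C \<and> q \<in> C \<and> C \<subseteq> W - \<Union>\<F>"
    if p: "p \<in> W - \<Union>\<F>" and q: "q \<in> W - \<Union>\<F>" for p q
  proof -
    define P where "P V \<longleftrightarrow> openin X V \<and> connectedin X V \<and> p \<in> V \<and> q \<in> V \<and> X closure_of V \<subseteq> W" for V
    have next_set: "\<exists>V'. openin X V' \<and> connectedin X V' \<and> p \<in> V' \<and> q \<in> V' \<and> X closure_of V' \<subseteq> V - F n"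
      if V: "openin X V" "connectedin X V" "p \<in> V" "q \<in> V" for V n
    proof -
      have "nonseparating X (F n)"
        using \<F>(2) F by blast
      then have "openin X (V - F n)" "connectedin X (V - F n)"
        using V unfolding nonseparating_def by blast+
      then show ?thesis
        using connected_open_compactly_contained[OF X(3) reg, of "V - F n" p q] p q V
        by (metis DiffD2 DiffI F UnionI rangeI)
    qed
    \<comment> \<open>Each step removes one set \<open>F n\<close> from the current connected open
      set and shrinks the result, keeping \<open>p\<close> and \<open>q\<close>, until its closure
      fits inside.\<close>
    have "\<exists>V. \<forall>n. P (V n) \<and> X closure_of V (Suc n) \<subseteq> V n - F n"
    proof (rule dependent_nat_choice)
      show "\<exists>V. P V"
        unfolding P_def using connected_open_compactly_contained[OF X(3) reg W] p q by (metis DiffD1)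
      fix V n assume "P V"
      then show "\<exists>V'. P V' \<and> X closure_of V' \<subseteq> V - F n"
        using next_set[of V n] closure_of_subset[of V X] openin_subset[of X V] unfolding P_def
        by (metis Diff_subset subset_trans)
    qed
    then obtain V where V: "\<And>n. P (V n)" "\<And>n. X closure_of V (Suc n) \<subseteq> V n - F n"
      by blast
    have VP: "V n \<subseteq> X closure_of V n" "connectedin X (X closure_of V n)" "p \<in> V n" "q \<in> V n" for n
      using V(1)[of n] unfolding P_def
      by (auto simp: closure_of_subset openin_subset connectedin_closure_of)
    have "connectedin X (\<Inter>n. X closure_of V n)"
    proof (rule connectedin_Inter_decseq[OF X(1,2)])
      show "decseq (\<lambda>n. X closure_of V n)"
        by (rule decseq_SucI) (use VP V(2) in blast)
    qed (use VP in auto)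
    moreover have "p \<in> (\<Inter>n. X closure_of V n)" "q \<in> (\<Inter>n. X closure_of V n)"
      using VP by blast+
    moreover have "x \<in> W - \<Union>\<F>" if "x \<in> (\<Inter>n. X closure_of V n)" for x
    proof -
      have "x \<in> X closure_of V n" for n
        using that by blast
      then have "x \<in> W" "x \<notin> F n" for n
        using V(2)[of n] V(1)[of 0] unfolding P_def by blast+
      then show ?thesis
        using F by blast
    qed
    ultimately show ?thesis
      by (meson subsetI)
  qed
  moreover have "W - \<Union>\<F> \<subseteq> topspace X"
    using W openin_subset by blast
  ultimately show ?thesis
    unfolding connectedin_def[of X "W - \<Union>\<F>"] connected_space_subconnected
    by (simp add: connectedin_subtopology Int_absorb1 del: Diff_iff) meson
qed (use W in auto)

text \<open>A relative of Sierpinski's theorem on partitions of continua into countably many closed sets.\<close>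

lemma closed_cover_overlapping_in_nonseparating:
  assumes X: "compact_space X" "Hausdorff_space X" "locally_connected_space X" "connected_space X"
      "topspace X \<noteq> {}"
    and \<F>: "countable \<F>" "\<And>F. F \<in> \<F> \<Longrightarrow> nonseparating X F"
    and E: "countable I" "\<And>i. i \<in> I \<Longrightarrow> closedin X (E i)" "topspace X = (\<Union>i\<in>I. E i)"
    and overlap: "\<And>i j. i \<in> I \<Longrightarrow> j \<in> I \<Longrightarrow> i \<noteq> j \<Longrightarrow> E i \<inter> E j \<subseteq> \<Union>\<F>"
  shows "\<exists>i\<in>I. E i = topspace X"
proof -
  have reg: "regular_space X" and lc: "locally_compact_space X"
    using X compact_Hausdorff_imp_regular_space compact_imp_locally_compact_space by blast+
  \<comment> \<open>Baire: countably many closed sets with empty interior do not cover a nonempty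
    open set.\<close>
  have dense: "W - \<Union>\<F> \<noteq> {}" if "openin X W" "W \<noteq> {}" for W
  proof
    assume "W - \<Union>\<F> = {}"
    moreover have "X interior_of \<Union>\<F> = {}"
      using \<F> lc reg by (intro Baire_category_alt) (auto simp: nonseparating_def)
    ultimately show False
      using that by (metis Diff_eq_empty_iff interior_of_maximal subset_empty)
  qed
  have covered: "W \<subseteq> E i" if W: "openin X W" and i: "i \<in> I" and "W - \<Union>\<F> \<subseteq> E i" for W i
    using dense[of "W - E i"] openin_diff[OF W E(2)[OF i]] that by blast
  \<comment> \<open>Outside \<open>\<Union>\<F>\<close>, the interior and the complement of
    \<open>E i\<close> split \<open>W\<close>, and \<open>W - \<Union>\<F>\<close> is connected. So
    only the first side occurs, and density together with closedness of \<open>E i\<close> recovers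
    the points of \<open>\<Union>\<F>\<close>.\<close>
  have clopen: "W \<subseteq> E i" if W: "openin X W" "connectedin X W" and i: "i \<in> I"
      and int: "W \<inter> E i - \<Union>\<F> \<subseteq> X interior_of E i" and ne: "W \<inter> E i - \<Union>\<F> \<noteq> {}" for W i
  proof (rule covered[OF W(1) i], rule ccontr)
    assume "\<not> W - \<Union>\<F> \<subseteq> E i"
    moreover have "connectedin X (W - \<Union>\<F>)"
      using connectedin_Diff_countable_nonseparating[OF X(1,2,3) \<F> W] .
    moreover have "openin X (X interior_of E i)" "openin X (topspace X - E i)"
      using E(2)[OF i] by auto
    moreover have iE: "X interior_of E i \<subseteq> E i"
      by (rule interior_of_subset)
    have WX: "W \<subseteq> topspace X"
      using W openin_subset by blast
    have "W - \<Union>\<F> \<subseteq> X interior_of E i \<union> (topspace X - E i)"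
      using WX int by blast
    moreover have "X interior_of E i \<inter> (topspace X - E i) \<inter> (W - \<Union>\<F>) = {}"
      using iE by blast
    moreover have "X interior_of E i \<inter> (W - \<Union>\<F>) \<noteq> {}"
      using ne int by blast
    moreover have "(topspace X - E i) \<inter> (W - \<Union>\<F>) \<noteq> {}"
      using \<open>\<not> W - \<Union>\<F> \<subseteq> E i\<close> WX by blast
    ultimately show False
      by (meson connectedinD)
  qed
  \<comment> \<open>The points of which no \<open>E i\<close> is a neighbourhood. Once
    \<open>Z\<close> is empty, \<open>clopen\<close> applies to the whole space.\<close>
  define Z where "Z = topspace X - (\<Union>i\<in>I. X interior_of E i)"
  have Zclo: "closedin X Z"
    unfolding Z_def by (intro closedin_diff openin_Union) auto
  have "Z = {}"
  proof (rule ccontr)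
    assume Zne: "Z \<noteq> {}"
    let ?Z = "subtopology X Z"
    have topZ: "topspace ?Z = Z"
      using Zclo by (simp add: Int_absorb1 closedin_subset)
    have "compact_space ?Z" "Hausdorff_space ?Z"
      using Zclo X by (simp_all add: closedin_compact_space compact_space_subtopology Hausdorff_space_subtopology)
    then have "locally_compact_space ?Z \<and> regular_space ?Z"
      using compact_Hausdorff_imp_regular_space compact_imp_locally_compact_space by blast
    moreover have "?Z interior_of (\<Union>((\<lambda>i. Z \<inter> E i) ` I)) \<noteq> {}"
    proof -
      have "\<Union>((\<lambda>i. Z \<inter> E i) ` I) = topspace ?Z"
        using topZ E(3) Zclo closedin_subset by fastforce
      then show ?thesis
        using topZ Zne by (metis interior_of_topspace)
    qed
    moreover have "countable ((\<lambda>i. Z \<inter> E i) ` I)"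
      using E(1) by blast
    \<comment> \<open>Baire inside the compact space \<open>Z\<close>: near some point of
      \<open>Z\<close>, all of \<open>Z\<close> lies in a single \<open>E i\<close>.\<close>
    ultimately obtain i where i: "i \<in> I" "\<not> (closedin ?Z (Z \<inter> E i) \<and> ?Z interior_of (Z \<inter> E i) = {})"
      using Baire_category_alt[of ?Z "(\<lambda>i. Z \<inter> E i) ` I"] by blast
    moreover have "closedin ?Z (Z \<inter> E i)"
      using E(2)[OF i(1)] closedin_subtopology_Int_closed by blast
    ultimately obtain x where "x \<in> ?Z interior_of (Z \<inter> E i)"
      by blast
    then obtain W0 where W0: "openin X W0" "x \<in> W0" "x \<in> Z" "W0 \<inter> Z \<subseteq> E i"
      unfolding interior_of_def openin_subtopology by auto
    then obtain W where W: "openin X W" "connectedin X W" "x \<in> W" "W \<subseteq> W0"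
      using X(3) unfolding locally_connected_space by meson
    have not_int: "\<not> W \<subseteq> E j" if "j \<in> I" for j
      using W W0(3) that interior_of_maximal[of W "E j" X] unfolding Z_def by blast
    \<comment> \<open>A point \<open>y\<close> of \<open>W\<close> outside \<open>E i\<close> and
      \<open>\<Union>\<F>\<close> lies in another \<open>E j\<close>. Points of
      \<open>W \<inter> E j\<close> outside \<open>\<Union>\<F>\<close> avoid \<open>E i\<close>,
      hence \<open>Z\<close>, so they are interior to some \<open>E k\<close>, and
      \<open>k = j\<close> by the overlap condition. Now \<open>clopen\<close> yields
      \<open>W \<subseteq> E j\<close>, although \<open>W\<close> contains
      \<open>x \<in> Z\<close>.\<close>
    then have "W - E i - \<Union>\<F> \<noteq> {}"
      using W(1) E(2) i(1) by (intro dense) auto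
    then obtain y where y: "y \<in> W" "y \<notin> E i" "y \<notin> \<Union>\<F>"
      by blast
    then obtain j where j: "j \<in> I" "y \<in> E j"
      using W(1) openin_subset E(3) by blast
    have "W \<inter> E j - \<Union>\<F> \<subseteq> X interior_of E j"
    proof
      fix z assume z: "z \<in> W \<inter> E j - \<Union>\<F>"
      then have "z \<notin> E i"
        using overlap i j y by blast
      then have "z \<notin> Z"
        using z W W0 by blast
      then obtain k where k: "k \<in> I" "z \<in> X interior_of E k"
        using z W(1) openin_subset unfolding Z_def by blast
      then have "k = j"
        using overlap[of k j] j z interior_of_subset by (metis DiffE IntE IntI subsetD)
      with k show "z \<in> X interior_of E j"
        by blast
    qed
    then have "W \<subseteq> E j"
      using clopen[OF W(1,2) j(1)] y j by blast
    with not_int j show False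
      by blast
  qed
  then have cover: "topspace X = (\<Union>i\<in>I. X interior_of E i)"
    unfolding Z_def using interior_of_subset_topspace[of X] by blast
  obtain x where x: "x \<in> topspace X" "x \<notin> \<Union>\<F>"
    using dense[OF openin_topspace X(5)] by blast
  then obtain i where i: "i \<in> I" "x \<in> X interior_of E i"
    using cover by auto
  have "topspace X \<inter> E i - \<Union>\<F> \<subseteq> X interior_of E i"
  proof
    fix z assume z: "z \<in> topspace X \<inter> E i - \<Union>\<F>"
    then obtain k where k: "k \<in> I" "z \<in> X interior_of E k"
      using cover by auto
    then have "k = i"
      using overlap[of k i] i z interior_of_subset by (metis DiffE IntE IntI subsetD)
    with k show "z \<in> X interior_of E i"
      by blast
  qed
  then have "topspace X \<subseteq> E i"
    using clopen[OF openin_topspace _ i(1)] X(4) x i interior_of_subset[of X "E i"]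
    by (auto simp: connectedin_topspace)
  then show ?thesis
    using i(1) E(2) closedin_subset by blast
qed

subsection \<open>Euclidean spaces\<close>

lemma connectedin_segment_Euclidean_space:
  assumes "x \<in> topspace (Euclidean_space n)" "y \<in> topspace (Euclidean_space n)"
  shows "connectedin (Euclidean_space n) ((\<lambda>t i. (1 - t) * x i + t * y i) ` {0..1})"
proof (rule connectedin_continuous_map_image)
  show "continuous_map euclideanreal (Euclidean_space n) (\<lambda>t i. (1 - t) * x i + t * y i)"
    using assms unfolding Euclidean_space_def continuous_map_in_subtopology continuous_map_componentwise_UNIV
    by (auto intro!: continuous_intros)
qed auto

text \<open>Coordinates count from 0, so \<open>Suc k\<close> is the last one. Every point outside
  \<open>T\<close> reaches the base point \<open>b\<close> by two segments: one leaves the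
  hyperplane orthogonally, the other runs to \<open>b\<close> and meets the hyperplane only
  there.\<close>

lemma connectedin_Euclidean_space_Diff_half_plane:
  assumes T: "T \<subseteq> {x. x (Suc k) = 0 \<and> 0 \<le> x k}"
  shows "connectedin (Euclidean_space (Suc (Suc k))) (topspace (Euclidean_space (Suc (Suc k))) - T)"
proof -
  let ?E = "Euclidean_space (Suc (Suc k))"
  \<comment> \<open>On the hyperplane, but outside the half that contains \<open>T\<close>.\<close>
  define b :: "nat \<Rightarrow> real" where "b = (\<lambda>i. if i = k then -1 else 0)"
  define seg :: "(nat \<Rightarrow> real) \<Rightarrow> (nat \<Rightarrow> real) \<Rightarrow> (nat \<Rightarrow> real) set"
    where "seg x y = (\<lambda>t i. (1 - t) * x i + t * y i) ` {0..1}" for x y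
  have ends: "x \<in> seg x y" "y \<in> seg x y" for x y
    unfolding seg_def by (rule image_eqI[of _ _ 0], simp_all) (rule image_eqI[of _ _ 1], simp_all)
  have b: "b \<in> topspace ?E" "b \<notin> T"
    using T by (auto simp: b_def topspace_Euclidean_space)
  have "\<exists>C. connectedin ?E C \<and> b \<in> C \<and> y \<in> C \<and> C \<subseteq> topspace ?E - T"
    if y: "y \<in> topspace ?E" "y \<notin> T" for y
  proof -
    \<comment> \<open>The direction leading away from the hyperplane. The last coordinate vanishes
      on the segment from \<open>y\<close> to \<open>z\<close> at most at \<open>y\<close>, which is
      not in \<open>T\<close>.\<close>
    define s :: real where "s = (if y (Suc k) \<ge> 0 then 1 else -1)"
    define z where "z = y (Suc k := y (Suc k) + s)"
    have z: "z \<in> topspace ?E"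
      using y by (auto simp: z_def topspace_Euclidean_space)
    have s0: "s * y (Suc k) \<ge> 0" "s * s = 1"
      by (auto simp: s_def)
    have con: "connectedin ?E (seg y z)" "connectedin ?E (seg z b)"
      using connectedin_segment_Euclidean_space y z b unfolding seg_def by blast+
    have "x \<notin> T" if x: "x \<in> seg y z" for x
    proof -
      obtain t where t: "0 \<le> t" "t \<le> 1" "x = (\<lambda>i. (1 - t) * y i + t * z i)"
        using x unfolding seg_def by auto
      show ?thesis
      proof (cases "t = 0")
        case False
        have "x (Suc k) = y (Suc k) + t * s"
          by (simp add: t z_def algebra_simps)
        then have "s * x (Suc k) = s * y (Suc k) + t"
          using s0(2) by (simp add: algebra_simps)
        with s0 t False have "x (Suc k) \<noteq> 0"
          by auto
        with T show ?thesis
          by blast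
      qed (use t y in simp)
    qed
    moreover have "x \<notin> T" if x: "x \<in> seg z b" for x
    proof -
      obtain t where t: "0 \<le> t" "t \<le> 1" "x = (\<lambda>i. (1 - t) * z i + t * b i)"
        using x unfolding seg_def by auto
      have "x (Suc k) = (1 - t) * (y (Suc k) + s)"
        by (simp add: t z_def b_def)
      moreover have "y (Suc k) + s \<noteq> 0"
        by (auto simp: s_def)
      ultimately have "t = 1" if "x (Suc k) = 0"
        using that by simp
      moreover have "x k < 0" if "t = 1"
        using that by (simp add: t b_def)
      ultimately show ?thesis
        using T by fastforce
    qed
    moreover have "seg y z \<union> seg z b \<subseteq> topspace ?E"
      using con connectedin_subset_topspace by blast
    ultimately have "seg y z \<union> seg z b \<subseteq> topspace ?E - T"
      by blast
    moreover have "seg y z \<inter> seg z b \<noteq> {}"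
      using ends(2)[of z y] ends(1)[of z b] by blast
    then have "connectedin ?E (seg y z \<union> seg z b)"
      using con connectedin_Un by blast
    moreover have "y \<in> seg y z \<union> seg z b" "b \<in> seg y z \<union> seg z b"
      using ends by blast+
    ultimately show ?thesis
      by blast
  qed
  then obtain C where C: "\<And>y. y \<in> topspace ?E - T \<Longrightarrow> connectedin ?E (C y) \<and> b \<in> C y \<and> y \<in> C y \<and> C y \<subseteq> topspace ?E - T"
    by (metis DiffE)
  then have "topspace ?E - T = (\<Union>y\<in>topspace ?E - T. C y)"
    using C by blast
  moreover have "connectedin ?E (\<Union>y\<in>topspace ?E - T. C y)"
    using C b by (intro connectedin_Union) auto
  ultimately show ?thesis
    by simp
qed

section \<open>Closed sets that embed in codimension two\<close>

lemma continuous_map_Euclidean_space_component: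
  "continuous_map (Euclidean_space n) euclideanreal (\<lambda>x. x i)"
  unfolding Euclidean_space_def by (intro continuous_map_from_subtopology continuous_map_product_projection) simp

lemma compactin_Euclidean_space_bounded:
  assumes "closedin (Euclidean_space n) S" and bd: "\<And>x i. x \<in> S \<Longrightarrow> i < n \<Longrightarrow> \<bar>x i\<bar> \<le> c"
  shows "compactin (Euclidean_space n) S"
proof -
  \<comment> \<open>Points of \<open>Euclidean_space n\<close> are sequences that vanish from index
    \<open>n\<close> on, hence the factors \<open>{0}\<close> in this Tychonoff box.\<close>
  let ?B = "PiE UNIV (\<lambda>i. if i < n then {-c..c} else {0::real})"
  have "compactin (powertop_real UNIV) ?B"
    by (auto simp: compactin_PiE)
  then have "compactin (Euclidean_space n) ?B"
    unfolding Euclidean_space_def compactin_subtopology by (fastforce simp: PiE_iff split: if_splits)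
  moreover have "S \<subseteq> ?B"
    using bd closedin_subset[OF assms(1)] by (fastforce simp: topspace_Euclidean_space PiE_iff)
  ultimately show ?thesis
    using closed_compactin assms(1) by blast
qed

text \<open>As \<open>A\<close> is closed, \<open>\<lambda>x. \<bar>x\<bar>\<^sup>2\<close> is proper on it; adjoining this function to the given
  embedding into a space of codimension two gives a closed copy of \<open>A\<close> in a half-hyperplane of codimension one,
  and closed copies have complements with equally many components.\<close>

lemma connectedin_Euclidean_complement_codim_2:
  assumes A: "closedin (Euclidean_space (Suc (Suc k))) A"
    and hom: "subtopology (Euclidean_space (Suc (Suc k))) A homeomorphic_space subtopology (Euclidean_space k) B"
  shows "connectedin (Euclidean_space (Suc (Suc k))) (topspace (Euclidean_space (Suc (Suc k))) - A)"
    and "A \<noteq> topspace (Euclidean_space (Suc (Suc k)))"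
proof -
  let ?n = "Suc (Suc k)"
  let ?E = "Euclidean_space ?n"
  let ?A = "subtopology ?E A"
  have topA: "topspace ?A = A"
    using A by (simp add: Int_absorb1 closedin_subset)
  obtain f g where fg: "homeomorphic_maps ?A (subtopology (Euclidean_space k) B) f g"
    using hom unfolding homeomorphic_space_def by blast
  then have f: "continuous_map ?A (Euclidean_space k) f" and gf: "\<And>x. x \<in> A \<Longrightarrow> g (f x) = x"
    using topA by (auto simp: homeomorphic_maps_def continuous_map_in_subtopology)
  have fi: "continuous_map ?A euclideanreal (\<lambda>x. f x i)" for i
    using continuous_map_compose[OF f continuous_map_Euclidean_space_component[of k i]] by (simp add: o_def)
  have f0: "f x i = 0" if "x \<in> A" "i \<ge> k" for x i
    using f that topA unfolding continuous_map_def by (auto simp: topspace_Euclidean_space Pi_iff)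
  have pr: "continuous_map ?A euclideanreal (\<lambda>x. x i)" for i
    by (intro continuous_map_from_subtopology continuous_map_Euclidean_space_component)
  define u where "u x = (\<Sum>j<?n. x j ^ 2)" for x :: "nat \<Rightarrow> real"
  have u: "continuous_map ?A euclideanreal u"
    unfolding u_def by (intro continuous_intros pr) auto
  \<comment> \<open>The coordinates are those of \<open>f x\<close>, then the squared norm, then 0
    in position \<open>Suc k\<close>. Injectivity comes from \<open>f\<close> alone, the squared
    norm gives properness.\<close>
  define e where "e x = (\<lambda>i. if i < ?n then if i < k then f x i else if i = k then u x else 0 else 0)" for x
  have e: "continuous_map ?A ?E e"
    unfolding e_def continuous_map_componentwise_Euclidean_space
  proof (intro allI impI)
    fix i
    show "continuous_map ?A euclideanreal (\<lambda>x. if i < k then f x i else if i = k then u x else 0)"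
      using fi[of i] u by (cases "i < k"; cases "i = k") auto
  qed
  have inj: "inj_on e A"
  proof (rule inj_onI)
    fix x y assume xy: "x \<in> A" "y \<in> A" "e x = e y"
    have "f x i = f y i" for i
      using fun_cong[OF xy(3), of i] f0[of x i] f0[of y i] xy by (cases "i < k") (auto simp: e_def)
    then have "f x = f y"
      by blast
    then show "x = y"
      using gf xy by metis
  qed
  \<comment> \<open>Coordinate \<open>k\<close> is bounded on a compact \<open>K\<close> and equals
    \<open>u x\<close> at \<open>e x\<close>, so the preimage of \<open>K\<close> is bounded. It is
    closed in the whole space because \<open>A\<close> is.\<close>
  have "proper_map ?A ?E e"
  proof (rule compact_imp_proper_map)
    show "k_space ?E"
      by (simp add: locally_compact_Euclidean_space locally_compact_imp_k_space)
    show "kc_space ?E"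
      by (simp add: Hausdorff_Euclidean_space Hausdorff_imp_kc_space)
    show "e \<in> topspace ?A \<rightarrow> topspace ?E"
      using e continuous_map_funspace by blast
    show "continuous_map ?A ?E e \<or> kc_space ?A"
      using e by blast
    fix K assume K: "compactin ?E K"
    have "closedin ?E K"
      using K Hausdorff_Euclidean_space compactin_imp_closedin by blast
    then have "closedin ?A {x \<in> topspace ?A. e x \<in> K}"
      using e closedin_continuous_map_preimage by blast
    then have clo: "closedin ?E {x \<in> A. e x \<in> K}"
      using A unfolding topA by (rule closedin_trans_full)
    have "compactin euclideanreal ((\<lambda>x. x k) ` K)"
      using K continuous_map_Euclidean_space_component image_compactin by blast
    then obtain c where c: "\<And>x. x \<in> K \<Longrightarrow> \<bar>x k\<bar> \<le> c"
      using compact_imp_bounded bounded_iff by (metis (no_types, lifting) compactin_euclidean_iff imageI real_norm_def)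
    have "\<bar>x i\<bar> \<le> sqrt c" if x: "x \<in> {x \<in> A. e x \<in> K}" and "i < ?n" for x i
    proof -
      have "x i ^ 2 \<le> u x"
        unfolding u_def using \<open>i < ?n\<close> by (intro member_le_sum) auto
      also have "u x = e x k"
        by (simp add: e_def)
      also have "\<dots> \<le> c"
        using c x by fastforce
      finally show ?thesis
        using real_le_rsqrt real_sqrt_abs real_sqrt_le_iff by metis
    qed
    then have "compactin ?E {x \<in> A. e x \<in> K}"
      using compactin_Euclidean_space_bounded[OF clo] by blast
    then show "compactin ?A {x \<in> topspace ?A. e x \<in> K}"
      unfolding topA by (auto simp: compactin_subtopology)
  qed
  then have closed: "closed_map ?A ?E e"
    by (simp add: proper_imp_closed_map)
  then have cloT: "closedin ?E (e ` A)"
    using topA unfolding closed_map_def by (metis closedin_topspace)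
  have homT: "?A homeomorphic_space subtopology ?E (e ` A)"
    using embedding_map_imp_homeomorphic_space[OF injective_closed_imp_embedding_map[OF e closed]] inj topA
    by simp
  have half: "e ` A \<subseteq> {x. x (Suc k) = 0 \<and> 0 \<le> x k}"
    by (auto simp: e_def u_def simp del: sum.lessThan_Suc intro!: sum_nonneg)
  show "connectedin ?E (topspace ?E - A)"
    using connectedin_Euclidean_space_Diff_half_plane[OF half] connected_in_Euclidean_complements[OF A cloT homT]
    by blast
  show "A \<noteq> topspace ?E"
  proof
    \<comment> \<open>Then \<open>e\<close> A\<open>would be a closed copy of the whole space, hence
      the whole space by invariance of dimension. But\<close>e \<open>A\<close> lies in a
      half-hyperplane.\<close>
    assume "A = topspace ?E"
    then have "subtopology ?E (e ` A) homeomorphic_space ?E"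
      using homT homeomorphic_space_sym by force
    then have eA: "e ` A = topspace ?E"
      using invariance_of_dimension_closedin_Euclidean_space[OF cloT] by blast
    define b :: "nat \<Rightarrow> real" where "b = (\<lambda>i. if i = k then -1 else 0)"
    have "b \<in> e ` A"
      unfolding eA by (auto simp: b_def topspace_Euclidean_space)
    then have "0 \<le> b k"
      using half by blast
    then show False
      by (simp add: b_def)
  qed
qed

section \<open>Open boxes as copies of the whole Euclidean space\<close>

lemma continuous_map_product_map:
  assumes f: "\<And>i. i \<in> I \<Longrightarrow> continuous_map (X i) (Y i) (f i)"
  shows "continuous_map (product_topology X I) (product_topology Y I) (\<lambda>x. \<lambda>i\<in>I. f i (x i))"
  unfolding continuous_map_componentwise
proof (intro conjI ballI)
  fix i assume i: "i \<in> I"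
  have "continuous_map (product_topology X I) (Y i) (f i \<circ> (\<lambda>x. x i))"
    by (rule continuous_map_compose[OF _ f[OF i]]) (rule continuous_map_product_projection[OF i])
  with i show "continuous_map (product_topology X I) (Y i) (\<lambda>x. (\<lambda>i\<in>I. f i (x i)) i)"
    by (simp add: o_def)
qed auto

lemma homeomorphic_space_product_topology:
  assumes "\<And>i. i \<in> I \<Longrightarrow> X i homeomorphic_space Y i"
  shows "product_topology X I homeomorphic_space product_topology Y I"
proof -
  obtain f g where fg: "\<And>i. i \<in> I \<Longrightarrow> homeomorphic_maps (X i) (Y i) (f i) (g i)"
    using assms unfolding homeomorphic_space_def by metis
  have "homeomorphic_maps (product_topology X I) (product_topology Y I)
      (\<lambda>x. \<lambda>i\<in>I. f i (x i)) (\<lambda>x. \<lambda>i\<in>I. g i (x i))"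
    unfolding homeomorphic_maps_def
    using fg by (auto intro!: continuous_map_product_map simp: homeomorphic_maps_def PiE_iff extensional_def fun_eq_iff)
  then show ?thesis
    unfolding homeomorphic_space_def by blast
qed

text \<open>In the model as a finite product of lines, a small box is a product of open intervals,
  each homeomorphic to the line.\<close>

lemma Euclidean_space_neighbourhood_base:
  assumes "openin (Euclidean_space n) W" "y \<in> W"
  obtains B where "openin (Euclidean_space n) B" "y \<in> B" "B \<subseteq> W"
    "subtopology (Euclidean_space n) B homeomorphic_space Euclidean_space n"
proof -
  let ?P = "product_topology (\<lambda>i. euclideanreal) {..<n}"
  obtain h h' where hh: "homeomorphic_maps (Euclidean_space n) ?P h h'"
    using homeomorphic_Euclidean_space_product_topology unfolding homeomorphic_space_def by blast
  then have h: "homeomorphic_map (Euclidean_space n) ?P h" and h': "homeomorphic_map ?P (Euclidean_space n) h'"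
    using homeomorphic_maps_map by blast+
  have WE: "W \<subseteq> topspace (Euclidean_space n)"
    using assms openin_subset by blast
  have "openin ?P (h ` W)"
    using h assms WE homeomorphic_map_openness_eq by blast
  moreover have "h y \<in> h ` W"
    using assms(2) by blast
  ultimately obtain U where "\<forall>i\<in>{..<n}. openin euclideanreal (U i)" "h y \<in> PiE {..<n} U" "PiE {..<n} U \<subseteq> h ` W"
    unfolding openin_product_topology_alt by (metis (no_types, lifting))
  then have U: "\<And>i. i < n \<Longrightarrow> open (U i)" "\<And>i. i < n \<Longrightarrow> h y i \<in> U i" "PiE {..<n} U \<subseteq> h ` W" "h y \<in> PiE {..<n} U"
    by (simp_all add: PiE_iff)
  have "\<exists>e>0. {h y i - e<..<h y i + e} \<subseteq> U i" if "i < n" for i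
    using U(1,2)[OF that] by (metis open_contains_ball ball_eq_greaterThanLessThan)
  then obtain e where e: "\<And>i. i < n \<Longrightarrow> e i > 0 \<and> {h y i - e i<..<h y i + e i} \<subseteq> U i"
    by metis
  define J where "J i = {h y i - e i<..<h y i + e i}" for i
  define C where "C = PiE {..<n} J"
  have J: "open (J i)" "h y i \<in> J i" "J i \<subseteq> U i" if "i < n" for i
    using e[OF that] by (auto simp: J_def)
  have "openin ?P C"
    unfolding C_def using J(1) by (simp add: openin_PiE)
  moreover have "h y \<in> C"
    unfolding C_def using U(4) J(2) by (simp add: PiE_iff)
  moreover have "C \<subseteq> PiE {..<n} U"
    unfolding C_def by (rule PiE_mono) (use J(3) in simp)
  ultimately have C: "openin ?P C" "h y \<in> C" "C \<subseteq> h ` W"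
    using U(3) by blast+
  have "subtopology ?P C = product_topology (\<lambda>i. subtopology euclideanreal (J i)) {..<n}"
    unfolding C_def by (rule subtopology_product_topology)
  moreover have "product_topology (\<lambda>i. subtopology euclideanreal (J i)) {..<n} homeomorphic_space ?P"
  proof (rule homeomorphic_space_product_topology)
    fix i assume "i \<in> {..<n}"
    then have "h y i - e i < h y i + e i"
      using e[of i] by simp
    then have "J i homeomorphic (UNIV :: real set)"
      unfolding J_def by (rule homeomorphic_open_interval_UNIV)
    then show "subtopology euclideanreal (J i) homeomorphic_space euclideanreal"
      by (metis homeomorphic_space_iff_homeomorphic subtopology_UNIV)
  qed
  ultimately have CP: "subtopology ?P C homeomorphic_space ?P"
    by simp
  have "C \<subseteq> topspace ?P"
    using C(1) openin_subset by blast
  moreover have inv: "h' (h x) = x" if "x \<in> W" for x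
    using hh WE that unfolding homeomorphic_maps_def by blast
  ultimately have "openin (Euclidean_space n) (h' ` C)"
    using C(1) h' homeomorphic_map_openness_eq by blast
  moreover have "y \<in> h' ` C"
    using C(2) inv[OF assms(2)] by (metis imageI)
  moreover have sub: "h' ` C \<subseteq> W"
    using C(3) inv by fastforce
  moreover have "subtopology (Euclidean_space n) (h' ` C) homeomorphic_space Euclidean_space n"
  proof -
    have "homeomorphic_map (subtopology ?P C) (subtopology (Euclidean_space n) (h' ` C)) h'"
      using h' \<open>C \<subseteq> topspace ?P\<close> homeomorphic_imp_injective_map[OF h'] sub WE
      by (intro homeomorphic_map_subtopologies) (auto simp: inj_on_def)
    then have "subtopology (Euclidean_space n) (h' ` C) homeomorphic_space subtopology ?P C"
      using homeomorphic_map_imp_homeomorphic_space homeomorphic_space_sym by blast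
    then show ?thesis
      using CP homeomorphic_Euclidean_space_product_topology homeomorphic_space_sym homeomorphic_space_trans by blast
  qed
  ultimately show ?thesis
    using that by blast
qed

subsection \<open>Submanifolds of codimension two\<close>

text \<open>The charts in the definition map onto open subsets only. With charts onto the whole
  Euclidean space, relatively closed subsets of \<open>N\<close> become closed subsets of
  \<open>Euclidean_space n\<close>, as the complement theorem requires.\<close>

lemma topological_manifold_neighbourhood_base:
  assumes X: "topological_manifold n X" and W: "openin X W" "x \<in> W"
  obtains N where "openin X N" "x \<in> N" "N \<subseteq> W" "subtopology X N homeomorphic_space Euclidean_space n"
proof -
  have "x \<in> topspace X"
    using W openin_subset by blast
  then obtain U V where UV: "openin X U" "x \<in> U" "openin (Euclidean_space n) V"
      "subtopology X U homeomorphic_space subtopology (Euclidean_space n) V"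
    using X unfolding topological_manifold_def by metis
  then obtain f where f: "homeomorphic_map (subtopology X U) (subtopology (Euclidean_space n) V) f"
    using homeomorphic_space by metis
  have top: "topspace (subtopology X U) = U" "topspace (subtopology (Euclidean_space n) V) = V"
    using UV by (simp_all add: Int_absorb1 openin_subset)
  have fU: "f ` U = V" "inj_on f U"
    using homeomorphic_imp_surjective_map[OF f] homeomorphic_imp_injective_map[OF f] top by simp_all
  have "openin (subtopology X U) (U \<inter> W)"
    using UV W by (simp add: openin_open_subtopology openin_Int)
  then have "openin (subtopology (Euclidean_space n) V) (f ` (U \<inter> W))"
    using homeomorphic_map_openness_eq[OF f] by blast
  then have "openin (Euclidean_space n) (f ` (U \<inter> W))"
    using UV(3) by (simp add: openin_open_subtopology)
  moreover have "f x \<in> f ` (U \<inter> W)"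
    using UV W by blast
  ultimately obtain B where B: "openin (Euclidean_space n) B" "f x \<in> B" "B \<subseteq> f ` (U \<inter> W)"
      "subtopology (Euclidean_space n) B homeomorphic_space Euclidean_space n"
    by (rule Euclidean_space_neighbourhood_base)
  define N where "N = {z \<in> U. f z \<in> B}"
  have BV: "B \<subseteq> V"
    using B(3) fU(1) by blast
  have fN: "f ` N = B"
    unfolding N_def using BV fU(1) by blast
  have NU: "N \<subseteq> U"
    unfolding N_def by blast
  have "openin (subtopology (Euclidean_space n) V) B"
    using B(1) BV UV(3) by (simp add: openin_open_subtopology)
  then have "openin (subtopology X U) N"
    using homeomorphic_map_openness_eq[OF f, of N] NU unfolding fN top by simp
  then have "openin X N"
    using UV(1) by (simp add: openin_open_subtopology)
  moreover have "x \<in> N"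
    unfolding N_def using UV B by blast
  moreover have "N \<subseteq> W"
  proof
    fix z assume z: "z \<in> N"
    then obtain w where "w \<in> U \<inter> W" "f z = f w"
      using B(3) unfolding N_def by blast
    then show "z \<in> W"
      using z NU fU(2) by (metis IntD1 IntD2 inj_onD subsetD)
  qed
  moreover have "homeomorphic_map (subtopology (subtopology X U) N) (subtopology (subtopology (Euclidean_space n) V) B) f"
    by (rule homeomorphic_map_subtopologies[OF f]) (unfold top, simp add: Int_absorb1 NU BV fN)
  then have "subtopology X N homeomorphic_space subtopology (Euclidean_space n) B"
    using NU BV by (metis homeomorphic_map_imp_homeomorphic_space inf.absorb_iff2 subtopology_subtopology)
  then have "subtopology X N homeomorphic_space Euclidean_space n"
    using B(4) homeomorphic_space_trans by blast
  ultimately show ?thesis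
    by (rule that)
qed

lemma topological_manifold_imp_locally_connected_space:
  assumes X: "topological_manifold n X"
  shows "locally_connected_space X"
  unfolding locally_connected_space
proof (intro allI impI, elim conjE)
  fix W x assume W: "openin X W" "x \<in> W"
  obtain N where N: "openin X N" "x \<in> N" "N \<subseteq> W" "subtopology X N homeomorphic_space Euclidean_space n"
    using topological_manifold_neighbourhood_base[OF X W] .
  have "connectedin X N"
    using N(1,4) homeomorphic_connected_space[OF N(4)] connected_Euclidean_space
    by (simp add: connectedin_def openin_subset)
  with N show "\<exists>U. openin X U \<and> connectedin X U \<and> x \<in> U \<and> U \<subseteq> W"
    by blast
qed

lemma homeomorphic_subspace:
  assumes "X homeomorphic_space Y" "S \<subseteq> topspace X"
  obtains T where "T \<subseteq> topspace Y" "subtopology X S homeomorphic_space subtopology Y T"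
proof -
  obtain f where f: "homeomorphic_map X Y f"
    using assms(1) homeomorphic_space by metis
  have sub: "f ` S \<subseteq> topspace Y"
    using homeomorphic_imp_surjective_map[OF f] assms(2) by blast
  then have "homeomorphic_map (subtopology X S) (subtopology Y (f ` S)) f"
    using assms(2) by (intro homeomorphic_map_subtopologies[OF f]) (simp add: Int_absorb1)
  with sub show ?thesis
    using that homeomorphic_map_imp_homeomorphic_space by blast
qed

text \<open>Near a point of \<open>F\<close>, a chart of \<open>X\<close> turns \<open>F\<close>
  into a closed subset of \<open>Euclidean_space n\<close>, while an unrelated chart of
  \<open>S\<close> embeds the same piece of \<open>F\<close> in \<open>Euclidean_space k\<close>.
  The complement theorem needs no compatibility of the two, so \<open>S\<close> may be wild.\<close>

lemma nonseparating_closed_subset_of_codim_2: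
  assumes S: "submanifold_of_codim 2 n X S" and F: "closedin X F" "F \<subseteq> S"
  shows "nonseparating X F"
proof (rule nonseparating_local[OF F(1)])
  have X: "topological_manifold n X" and SX: "S \<subseteq> topspace X"
    using S unfolding submanifold_of_codim_def by blast+
  fix x W assume W: "openin X W" "x \<in> W"
  show "\<exists>N. openin X N \<and> x \<in> N \<and> N \<subseteq> W \<and> connectedin X (N - F) \<and> N - F \<noteq> {}"
  proof (cases "x \<in> F")
    case False
    have "openin X (W - F)" "x \<in> W - F"
      using W F False by auto
    then obtain N where N: "openin X N" "connectedin X N" "x \<in> N" "N \<subseteq> W - F"
      using topological_manifold_imp_locally_connected_space[OF X] unfolding locally_connected_space by metis
    then have "N - F = N"
      by blast
    with N show ?thesis
      by (intro exI[of _ N]) auto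
  next
    case True
    then have xS: "x \<in> S"
      using F by blast
    \<comment> \<open>The point \<open>x\<close> rules out the disjunct
      \<open>S = {}\<close>.\<close>
    then obtain k where k: "n = Suc (Suc k)" "topological_manifold k (subtopology X S)"
      using S unfolding submanifold_of_codim_def by force
    have "x \<in> topspace (subtopology X S)"
      using xS SX by auto
    then obtain U V where U: "openin (subtopology X S) U" "x \<in> U"
        "subtopology (subtopology X S) U homeomorphic_space subtopology (Euclidean_space k) V"
      using k(2) unfolding topological_manifold_def by metis
    then obtain O' where O': "openin X O'" "U = O' \<inter> S"
      unfolding openin_subtopology by blast
    have US: "U \<subseteq> S" "U \<subseteq> topspace X"
      using O' SX by blast+
    then have UX: "subtopology X U homeomorphic_space subtopology (Euclidean_space k) V"
      using U(3) by (simp add: subtopology_subtopology Int_absorb1)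
    \<comment> \<open>Choosing \<open>N\<close> inside \<open>O'\<close> forces
      \<open>N \<inter> F\<close> into the chart domain \<open>U\<close> of
      \<open>S\<close>.\<close>
    have "openin X (W \<inter> O')" "x \<in> W \<inter> O'"
      using W O' U(2) by auto
    then obtain N where N: "openin X N" "x \<in> N" "N \<subseteq> W \<inter> O'" "subtopology X N homeomorphic_space Euclidean_space n"
      using topological_manifold_neighbourhood_base[OF X] by metis
    have NX: "N \<subseteq> topspace X"
      using N(1) openin_subset by blast
    have NFU: "N \<inter> F \<subseteq> U"
      using N(3) O'(2) F(2) by blast
    obtain B where B: "subtopology (subtopology X U) (N \<inter> F) homeomorphic_space
        subtopology (subtopology (Euclidean_space k) V) B"
      using homeomorphic_subspace[OF UX, of "N \<inter> F"] NFU US by (metis topspace_subtopology_subset)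
    obtain f where f: "homeomorphic_map (subtopology X N) (Euclidean_space n) f"
      using N(4) homeomorphic_space by metis
    have topN: "topspace (subtopology X N) = N"
      using NX by (simp add: Int_absorb1)
    have fN: "f ` N = topspace (Euclidean_space n)" "inj_on f N"
      using homeomorphic_imp_surjective_map[OF f] homeomorphic_imp_injective_map[OF f] topN by simp_all
    define A where "A = f ` (N \<inter> F)"
    have "closedin (subtopology X N) (N \<inter> F)"
      using F(1) closedin_subtopology_Int_closed by blast
    then have A: "closedin (Euclidean_space n) A"
      unfolding A_def using homeomorphic_map_closedness_eq[OF f] by blast
    have "homeomorphic_map (subtopology (subtopology X N) (N \<inter> F)) (subtopology (Euclidean_space n) A) f"
      by (rule homeomorphic_map_subtopologies[OF f])
        (unfold topN fN(1)[symmetric] A_def, simp add: Int_absorb1 image_mono)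
    then have "subtopology (Euclidean_space n) A homeomorphic_space subtopology (subtopology X N) (N \<inter> F)"
      using homeomorphic_map_imp_homeomorphic_space homeomorphic_space_sym by blast
    \<comment> \<open>Both charts see the same subspace topology on \<open>N \<inter> F\<close>, so
      its image \<open>A\<close> embeds in \<open>Euclidean_space k\<close>.\<close>
    moreover have "subtopology (subtopology X N) (N \<inter> F) = subtopology (subtopology X U) (N \<inter> F)"
      using NFU by (simp add: subtopology_subtopology Int_absorb1)
    ultimately have "subtopology (Euclidean_space n) A homeomorphic_space subtopology (Euclidean_space k) (V \<inter> B)"
      using B homeomorphic_space_trans by (metis subtopology_subtopology)
    note AE = connectedin_Euclidean_complement_codim_2[OF A[unfolded k(1)] this[unfolded k(1)], folded k(1)]
    have img: "f ` (N - F) = topspace (Euclidean_space n) - A"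
      using fN unfolding A_def inj_on_def by blast
    then have "connectedin (subtopology X N) (N - F)"
      using homeomorphic_map_connectedness[OF f, of "N - F"] AE(1) unfolding topN by auto
    then have "connectedin X (N - F)"
      by (simp add: connectedin_subtopology)
    moreover have "N - F \<noteq> {}"
      using img AE(2) A closedin_subset by (metis Diff_eq_empty_iff image_empty subset_antisym)
    ultimately show ?thesis
      using N by blast
  qed
qed

subsection \<open>Orbit equivalences\<close>

text \<open>Otherwise \<open>inv g \<otimes> g'\<close> would be a nontrivial element fixing
  \<open>x\<close>.\<close>

lemma (in group_action) eq_of_free_point:
  assumes g: "g \<in> carrier G" "g' \<in> carrier G" and x: "x \<in> E" "\<phi> g x = \<phi> g' x"
    and free: "\<And>a. a \<in> carrier G \<Longrightarrow> a \<noteq> \<one> \<Longrightarrow> x \<notin> invariants E \<phi> a"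
  shows "g = g'"
proof (rule ccontr)
  assume "g \<noteq> g'"
  interpret group G
    using group_hom group_hom.axioms(1) by blast
  have "\<phi> (inv g \<otimes> g') x = \<phi> (inv g) (\<phi> g' x)"
    using g x by (intro composition_rule) auto
  also have "\<dots> = x"
    using orbit_sym_aux[OF g(1) x(1)] x(2) by simp
  finally have "x \<in> invariants E \<phi> (inv g \<otimes> g')"
    using x(1) by (simp add: invariants_def)
  moreover have "inv g \<otimes> g' \<noteq> \<one>"
    using \<open>g \<noteq> g'\<close> g by (metis inv_closed inv_equality inv_inv)
  ultimately show False
    using free[of "inv g \<otimes> g'"] g by simp
qed

text \<open>The maps \<open>\<phi> g\<close> are extensional, so agreement on \<open>E\<close> makes
  them equal as functions, and faithfulness is injectivity of \<open>\<phi>\<close>.\<close>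

lemma (in faithful_action) eqI:
  assumes "g \<in> carrier G" "g' \<in> carrier G" "\<And>x. x \<in> E \<Longrightarrow> \<phi> g x = \<phi> g' x"
  shows "g = g'"
proof -
  have "\<phi> g \<in> extensional E" "\<phi> g' \<in> extensional E"
    using assms bij_prop0 Bij_imp_extensional by blast+
  then have "\<phi> g = \<phi> g'"
    using assms(3) by (rule extensionalityI)
  then show ?thesis
    using assms faithful by (simp add: inj_on_eq_iff)
qed

text \<open>The sets where \<open>h\<close> agrees with one group element are closed and cover
  \<open>X\<close>. Where two of them meet, a nontrivial element has a fixed point, so one set is
  everything.\<close>

lemma orbit_preserving_map_is_group_element:
  assumes X: "compact_space X" "Hausdorff_space X" "locally_connected_space X" "connected_space X"
    and act: "faithful_top_action X G \<phi>" and G: "countable (carrier G)"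
    and Fix: "\<And>g. g \<in> carrier G \<Longrightarrow> g \<noteq> \<one>\<^bsub>G\<^esub> \<Longrightarrow> nonseparating X (invariants (topspace X) \<phi> g)"
    and h: "continuous_map X X h" "\<And>x. x \<in> topspace X \<Longrightarrow> h x \<in> orbit G \<phi> x"
  shows "\<exists>g\<in>carrier G. \<forall>x\<in>topspace X. h x = \<phi> g x"
proof -
  interpret faithful_action G "topspace X" \<phi>
    using act unfolding faithful_top_action_def by blast
  interpret group G
    using group_hom group_hom.axioms(1) by blast
  show ?thesis
  proof (cases "topspace X = {}")
    case False
    define D where "D g = {x \<in> topspace X. h x = \<phi> g x}" for g
    have "\<exists>g\<in>carrier G. D g = topspace X"
    proof (rule closed_cover_overlapping_in_nonseparating[OF X False])
      let ?\<F> = "invariants (topspace X) \<phi> ` (carrier G - {\<one>\<^bsub>G\<^esub>})"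
      show "countable ?\<F>"
        using G by blast
      show "nonseparating X F" if "F \<in> ?\<F>" for F
        using that Fix by blast
      show "closedin X (D g)" if "g \<in> carrier G" for g
        unfolding D_def using X(2) h(1) act that
        by (intro closedin_continuous_maps_eq)
          (auto simp: faithful_top_action_def homeomorphic_imp_continuous_map)
      show "topspace X = (\<Union>g\<in>carrier G. D g)"
        using h(2) by (auto simp: D_def orbit_def)
      show "D g \<inter> D g' \<subseteq> \<Union>?\<F>" if "g \<in> carrier G" "g' \<in> carrier G" "g \<noteq> g'" for g g'
      proof
        fix x assume "x \<in> D g \<inter> D g'"
        then have "x \<in> topspace X" "\<phi> g x = \<phi> g' x"
          by (auto simp: D_def)
        then show "x \<in> \<Union>?\<F>"
          using eq_of_free_point[of g g' x] that by blast
      qed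
    qed (rule G)
    then show ?thesis
      by (auto simp: D_def)
  qed auto
qed

section \<open>Construction of the group isomorphism\<close>

theorem theorem0p3:
  fixes X :: "'a topology" and n :: nat
    and G :: "('g, 'm) monoid_scheme" and \<phi> :: "'g \<Rightarrow> 'a \<Rightarrow> 'a"
  assumes "topological_manifold n X"
    and "compact_space X" and "connected_space X"
    and "faithful_top_action X G \<phi>"
    and "countable (carrier G)"
    and "\<And>g. g \<in> carrier G \<Longrightarrow> g \<noteq> \<one>\<^bsub>G\<^esub> \<Longrightarrow>
           \<exists>S. submanifold_of_codim 2 n X S \<and> invariants (topspace X) \<phi> g \<subseteq> S"
  shows "C0_OE_rigid TYPE('b) TYPE('h) X G \<phi>"
  unfolding C0_OE_rigid_def
proof (intro allI impI, elim conjE)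
  fix X' :: "'b topology" and G' :: "'h monoid" and \<phi>' f
  assume act': "faithful_top_action X' G' \<phi>'" and oe: "orbit_equivalence X' G' \<phi>' X G \<phi> f"
  have X: "compact_space X" "Hausdorff_space X" "locally_connected_space X" "connected_space X"
    using assms topological_manifold_imp_locally_connected_space by (auto simp: topological_manifold_def)
  interpret A: faithful_action G "topspace X" \<phi>
    using assms(4) unfolding faithful_top_action_def by blast
  interpret A': faithful_action G' "topspace X'" \<phi>'
    using act' unfolding faithful_top_action_def by blast
  interpret G: group G
    using A.group_hom group_hom.axioms(1) by blast
  interpret G': group G'
    using A'.group_hom group_hom.axioms(1) by blast
  have cont: "continuous_map X X (\<phi> g)" if "g \<in> carrier G" for g
    using assms(4) that by (simp add: faithful_top_action_def homeomorphic_imp_continuous_map)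
  have nonsep: "nonseparating X (invariants (topspace X) \<phi> g)" if g: "g \<in> carrier G" "g \<noteq> \<one>\<^bsub>G\<^esub>" for g
  proof -
    have "closedin X {x \<in> topspace X. \<phi> g x = x}"
      using X(2) cont[OF g(1)] continuous_map_id[of X] by (auto intro: closedin_continuous_maps_eq simp: id_def)
    then show ?thesis
      using assms(6)[OF g] nonseparating_closed_subset_of_codim_2 unfolding invariants_def by blast
  qed
  obtain k where fk: "homeomorphic_maps X' X f k"
    using oe unfolding orbit_equivalence_def homeomorphic_map_maps by blast
  then have f: "continuous_map X' X f" and k: "continuous_map X X' k"
      and kf: "\<And>y. y \<in> topspace X' \<Longrightarrow> k (f y) = y" and fk: "\<And>x. x \<in> topspace X \<Longrightarrow> f (k x) = x"
    unfolding homeomorphic_maps_def by blast+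
  have f_in: "f y \<in> topspace X" if "y \<in> topspace X'" for y
    using f that by (simp add: continuous_map_def Pi_iff)
  have k_in: "k x \<in> topspace X'" if "x \<in> topspace X" for x
    using k that by (simp add: continuous_map_def Pi_iff)
  have orb: "y' \<in> orbit G' \<phi>' y \<longleftrightarrow> f y' \<in> orbit G \<phi> (f y)" if "y \<in> topspace X'" "y' \<in> topspace X'" for y y'
    using oe that unfolding orbit_equivalence_def by blast
  \<comment> \<open>Conjugating \<open>\<phi>' a\<close> by \<open>f\<close> gives a continuous
    self-map of \<open>X\<close> that moves each point within its \<open>G\<close>-orbit.\<close>
  have "\<exists>g\<in>carrier G. \<forall>y\<in>topspace X'. f (\<phi>' a y) = \<phi> g (f y)" if a: "a \<in> carrier G'" for a
  proof -
    have "continuous_map X' X' (\<phi>' a)"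
      using act' a by (simp add: faithful_top_action_def homeomorphic_imp_continuous_map)
    then have "continuous_map X X (f \<circ> \<phi>' a \<circ> k)"
      by (intro continuous_map_compose[OF k continuous_map_compose[OF _ f]])
    moreover have "(f \<circ> \<phi>' a \<circ> k) x \<in> orbit G \<phi> x" if "x \<in> topspace X" for x
    proof -
      have "\<phi>' a (k x) \<in> orbit G' \<phi>' (k x)"
        using a by (auto simp: orbit_def)
      then show ?thesis
        using orb[of "k x" "\<phi>' a (k x)"] A'.element_image[OF a] k_in[OF that] fk[OF that] by simp
    qed
    ultimately obtain g where "g \<in> carrier G" "\<And>x. x \<in> topspace X \<Longrightarrow> (f \<circ> \<phi>' a \<circ> k) x = \<phi> g x"
      using orbit_preserving_map_is_group_element[OF X assms(4,5) nonsep] by metis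
    then show ?thesis
      using f_in kf by (metis comp_apply)
  qed
  then obtain \<theta> where \<theta>: "\<And>a. a \<in> carrier G' \<Longrightarrow> \<theta> a \<in> carrier G"
      "\<And>a y. a \<in> carrier G' \<Longrightarrow> y \<in> topspace X' \<Longrightarrow> f (\<phi>' a y) = \<phi> (\<theta> a) (f y)"
    by metis
  \<comment> \<open>Multiplicativity is checked pointwise on \<open>X\<close>, by faithfulness of
    \<open>\<phi>\<close>. Injectivity below uses faithfulness of \<open>\<phi>'\<close>
    instead.\<close>
  have "\<theta> \<in> hom G' G"
  proof (rule homI)
    fix a b assume ab: "a \<in> carrier G'" "b \<in> carrier G'"
    show "\<theta> (a \<otimes>\<^bsub>G'\<^esub> b) = \<theta> a \<otimes>\<^bsub>G\<^esub> \<theta> b"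
    proof (rule A.eqI)
      fix x assume x: "x \<in> topspace X"
      have kx: "\<phi>' b (k x) \<in> topspace X'"
        using A'.element_image[OF ab(2) k_in[OF x]] by blast
      have "\<phi> (\<theta> (a \<otimes>\<^bsub>G'\<^esub> b)) x = f (\<phi>' (a \<otimes>\<^bsub>G'\<^esub> b) (k x))"
        using \<theta>(2)[of "a \<otimes>\<^bsub>G'\<^esub> b" "k x"] ab k_in[OF x] fk[OF x] by simp
      also have "\<dots> = f (\<phi>' a (\<phi>' b (k x)))"
        using A'.composition_rule[OF k_in[OF x] ab] by simp
      also have "\<dots> = \<phi> (\<theta> a) (\<phi> (\<theta> b) x)"
        using \<theta>(2)[OF ab(1) kx] \<theta>(2)[OF ab(2) k_in[OF x]] fk[OF x] by simp
      also have "\<dots> = \<phi> (\<theta> a \<otimes>\<^bsub>G\<^esub> \<theta> b) x"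
        using A.composition_rule[OF x \<theta>(1)[OF ab(1)] \<theta>(1)[OF ab(2)]] by simp
      finally show "\<phi> (\<theta> (a \<otimes>\<^bsub>G'\<^esub> b)) x = \<phi> (\<theta> a \<otimes>\<^bsub>G\<^esub> \<theta> b) x" .
    qed (use ab \<theta>(1) in auto)
  qed (rule \<theta>(1))
  moreover have "inj_on \<theta> (carrier G')"
  proof (rule inj_onI)
    fix a b assume ab: "a \<in> carrier G'" "b \<in> carrier G'" "\<theta> a = \<theta> b"
    show "a = b"
    proof (rule A'.eqI[OF ab(1,2)])
      fix y assume y: "y \<in> topspace X'"
      then have "f (\<phi>' a y) = f (\<phi>' b y)"
        using \<theta>(2) ab by simp
      then show "\<phi>' a y = \<phi>' b y"
        using kf A'.element_image ab(1,2) y by metis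
    qed
  qed
  moreover have "g \<in> \<theta> ` carrier G'" if g: "g \<in> carrier G" for g
  proof (cases "topspace X = {}")
    \<comment> \<open>Over the empty space faithfulness makes \<open>G\<close> trivial.\<close>
    case True
    then have "g = \<theta> \<one>\<^bsub>G'\<^esub>"
      using g \<theta>(1) by (intro A.eqI) auto
    then show ?thesis
      by blast
  next
    case False
    let ?\<F> = "invariants (topspace X) \<phi> ` (carrier G - {\<one>\<^bsub>G\<^esub>})"
    \<comment> \<open>By Baire some point \<open>x\<close> has trivial stabilizer. The orbit
      relation supplies \<open>a\<close> such that \<open>\<theta> a\<close> and \<open>g\<close>
      agree at \<open>x\<close>, hence are equal.\<close>
    have "X interior_of \<Union>?\<F> = {}"
    proof (rule Baire_category_alt)
      show "completely_metrizable_space X \<or> locally_compact_space X \<and> regular_space X"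
        using X compact_Hausdorff_imp_regular_space compact_imp_locally_compact_space by blast
      show "countable ?\<F>"
        using assms(5) by blast
      show "closedin X T \<and> X interior_of T = {}" if "T \<in> ?\<F>" for T
        using that nonsep unfolding nonseparating_def by blast
    qed
    then have "\<not> topspace X \<subseteq> \<Union>?\<F>"
      using False by (metis interior_of_maximal openin_topspace subset_empty)
    then obtain x where x: "x \<in> topspace X" "x \<notin> \<Union>?\<F>"
      by blast
    have gx: "\<phi> g x \<in> topspace X"
      using A.element_image[OF g x(1)] by blast
    have "f (k (\<phi> g x)) \<in> orbit G \<phi> (f (k x))"
      using fk[OF x(1)] fk[OF gx] g by (auto simp: orbit_def)
    then have "k (\<phi> g x) \<in> orbit G' \<phi>' (k x)"
      using orb k_in gx x(1) by blast
    then obtain a where a: "a \<in> carrier G'" "k (\<phi> g x) = \<phi>' a (k x)"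
      by (auto simp: orbit_def)
    then have "\<phi> g x = \<phi> (\<theta> a) x"
      using \<theta>(2)[OF a(1) k_in[OF x(1)]] fk[OF x(1)] fk[OF gx] by simp
    then have "g = \<theta> a"
      using A.eq_of_free_point[OF g \<theta>(1)[OF a(1)] x(1)] x(2) by blast
    with a show ?thesis
      by blast
  qed
  ultimately have "\<theta> \<in> iso G' G"
    using \<theta>(1) unfolding iso_def bij_betw_def by blast
  then show "equivariant_map X' G' \<phi>' G \<phi> f"
    using \<theta>(2) unfolding equivariant_map_def by blast
qed

end
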